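(* Let $f:\mathbb{B}_n\to\mathbb{B}_m$ be holomorphic, let $a\in\mathbb{B}_n$ and $b=f(a)$, let $u\in T_a\mathbb{C}^n$, and let $u_*=f'(a)u$. Then $$M(b,u_* )\,|u_*|_e\leq M(a,u)\,|u|_e .$$
   Context: $\mathbb{B}_n$ is the open unit ball of $\mathbb{C}^n$ with the standard Hermitian inner product $\langle z,w\rangle=\sum_k z_k\overline{w_k}$; $|\cdot|_e$ is the Euclidean norm. For $a\in\mathbb{B}_n$ put $s_a=(1-|a|^2)^{1/2}$, let $P_a$ be the orthogonal projection of $\mathbb{C}^n$ onto the complex line $[a]$ spanned by $a$ ($P_a z=\frac{\langle z,a\rangle}{\langle a,a\rangle}a$ for $a\ne0$, $P_0=0$), $Q_a=I-P_a$, and $$\varphi_a(z)=\frac{a-P_az-s_aQ_az}{1-\langle z,a\rangle},$$ a biholomorphic automorphism of $\mathbb{B}_n$ with $\varphi_a(a)=0$. For $p\in\mathbb{B}_n$ and nonzero $u\in T_p\mathbb{C}^n\cong\mathbb{C}^n$, $$M(p,u)=\frac{|(d\varphi_p)_p\,u|_e}{|u|_e};$$ the product $M(p,u)|u|_e$ is understood as $|(d\varphi_p)_p u|_e$, so it equals $0$ when $u=0$. The same definitions are used on $\mathbb{B}_m$. *)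

theory Defs
  imports "HOL-Analysis.Analysis"
begin

definition cinner :: "complex ^ 'n \<Rightarrow> complex ^ 'n \<Rightarrow> complex" where
  "cinner z w = (\<Sum>k\<in>UNIV. z $ k * cnj (w $ k))"

definition proj_line :: "complex ^ 'n \<Rightarrow> complex ^ 'n \<Rightarrow> complex ^ 'n" where
  "proj_line a z = (if a = 0 then 0 else (cinner z a / cinner a a) *s a)"

definition ball_aut :: "complex ^ 'n \<Rightarrow> complex ^ 'n \<Rightarrow> complex ^ 'n" where
  "ball_aut a z =
     (1 / (1 - cinner z a)) *s
       (a - proj_line a z - complex_of_real (sqrt (1 - (norm a)\<^sup>2)) *s (z - proj_line a z))"

text \<open>The Frechet derivative of the library is only real-linear; complex differentiability asks
  in addition that it commute with complex scalars.\<close>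

definition holomorphic_map_on ::
    "(complex ^ 'n \<Rightarrow> complex ^ 'm) \<Rightarrow> (complex ^ 'n) set \<Rightarrow> bool" where
  "holomorphic_map_on f S \<longleftrightarrow>
     (\<forall>z\<in>S. \<exists>D. (f has_derivative D) (at z within S) \<and> Vector_Spaces.linear (*s) (*s) D)"

text \<open>For \<open>u = 0\<close> division by zero gives \<open>M_dil p 0 = 0\<close>, so \<open>M_dil p u * norm u\<close> is the norm of the
  derivative of \<open>ball_aut p\<close> at \<open>p\<close> applied to \<open>u\<close>, for every \<open>p\<close> in the unit ball and every \<open>u\<close>.\<close>

definition M_dil :: "complex ^ 'n \<Rightarrow> complex ^ 'n \<Rightarrow> real" where
  "M_dil p u = norm (frechet_derivative (ball_aut p) (at p) u) / norm u"

end

theory Submission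
  imports Defs "HOL-Complex_Analysis.Conformal_Mappings"
begin

text \<open>Put \<open>g = \<phi>\<^sub>b \<circ> f \<circ> \<phi>\<^sub>a\<close>, a holomorphic map between the balls with \<open>g 0 = 0\<close>. Restricting \<open>g\<close> to the
  complex line through a unit vector and pairing it with another unit vector gives a self-map of the
  disc, so the one-variable Schwarz lemma shows that \<open>g' 0\<close> is norm-decreasing. Since
  \<open>d\<phi>\<^sub>a 0\<close> inverts \<open>d\<phi>\<^sub>a a\<close>, evaluating \<open>g' 0\<close> at \<open>d\<phi>\<^sub>a a u\<close> gives the inequality.\<close>

section \<open>The Hermitian inner product\<close>

lemma cinner_add_left: "cinner (x + y) w = cinner x w + cinner y w"
  and cinner_diff_left: "cinner (x - y) w = cinner x w - cinner y w"
  and cinner_diff_right: "cinner w (x - y) = cinner w x - cinner w y"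
  and cinner_scale_left: "cinner (c *s x) w = c * cinner x w"
  and cinner_scale_right: "cinner w (c *s x) = cnj c * cinner w x"
  by (simp_all add: cinner_def algebra_simps sum.distrib sum_subtractf sum_distrib_left)

lemma cinner_zero_left [simp]: "cinner 0 w = 0"
  by (simp add: cinner_def)

lemma cinner_commute: "cinner y x = cnj (cinner x y)"
  by (simp add: cinner_def mult.commute)

lemma cinner_self: "cinner x x = complex_of_real ((norm x)\<^sup>2)"
  unfolding cinner_def norm_vec_def L2_set_def
  by (simp add: sum_nonneg complex_norm_square del: of_real_power)

lemma norm_cinner_le: "norm (cinner x y) \<le> norm x * norm y"
proof -
  have "norm (cinner x y) \<le> (\<Sum>i\<in>UNIV. \<bar>norm (x $ i)\<bar> * \<bar>norm (y $ i)\<bar>)"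
    unfolding cinner_def by (rule order_trans[OF norm_sum]) (simp add: norm_mult)
  also have "\<dots> \<le> norm x * norm y"
    unfolding norm_vec_def by (rule L2_set_mult_ineq)
  finally show ?thesis .
qed

lemma norm_cscale: "norm (c *s x) = norm c * norm (x :: complex ^ 'n)"
  unfolding norm_vec_def by (simp add: norm_mult L2_set_right_distrib)

lemma scaleR_eq_cscale: "r *\<^sub>R x = complex_of_real r *s (x :: complex ^ 'n)"
  by (simp add: vec_eq_iff scaleR_complex.code complex_eq_iff)

text \<open>Gives the product rule for \<open>*s\<close> with a varying complex scalar, the form in
  which \<open>ball_aut\<close> is differentiated.\<close>

lemma bounded_bilinear_cscale: "bounded_bilinear (\<lambda>c (x :: complex ^ 'n). c *s x)"
  by (rule bounded_bilinear.intro)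
     (auto simp: vec_eq_iff algebra_simps norm_cscale intro!: exI[of _ 1])

lemma bounded_linear_cinner_left: "bounded_linear (\<lambda>x. cinner x w)"
  by (rule bounded_linear_intro[where K = "norm w"])
     (auto simp: cinner_add_left scaleR_eq_cscale cinner_scale_left scaleR_conv_of_real norm_cinner_le)

lemmas has_derivative_cscale [derivative_intros] =
  bounded_bilinear.FDERIV[OF bounded_bilinear_cscale]

lemmas has_derivative_cinner_left [derivative_intros] =
  bounded_linear.has_derivative[OF bounded_linear_cinner_left]

section \<open>Holomorphic maps between balls\<close>

text \<open>Additivity already comes with a Frechet derivative, so complex homogeneity is all that
  remains.\<close>

lemma complex_linear_has_derivativeI:
  fixes D :: "complex ^ 'n \<Rightarrow> complex ^ 'm"
  assumes "(f has_derivative D) F" and "\<And>c x. D (c *s x) = c *s D x"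
  shows "Vector_Spaces.linear (*s) (*s) D"
proof -
  interpret bounded_linear D by (rule has_derivative_bounded_linear[OF assms(1)])
  show ?thesis by unfold_locales (auto simp: add assms(2))
qed

text \<open>At a point of an open set the derivative is unique, so the complex-linear witness is
  \<open>frechet_derivative\<close> itself.\<close>

lemma holomorphic_map_onD:
  assumes "holomorphic_map_on f S" "open S" "z \<in> S"
  shows "(f has_derivative frechet_derivative f (at z)) (at z)"
    and "frechet_derivative f (at z) (c *s x) = c *s frechet_derivative f (at z) x"
proof -
  from assms obtain D where D: "(f has_derivative D) (at z)"
      and lin: "Vector_Spaces.linear (*s) (*s) D"
    unfolding holomorphic_map_on_def by (auto simp: at_within_open[of z S])
  have "frechet_derivative f (at z) = D" using frechet_derivative_at[OF D] by simp
  moreover have "D (c *s x) = c *s D x"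
    using lin by (rule vec.linear_scale)
  ultimately show "(f has_derivative frechet_derivative f (at z)) (at z)"
    and "frechet_derivative f (at z) (c *s x) = c *s frechet_derivative f (at z) x"
    using D by simp_all
qed

lemma holomorphic_map_onI:
  assumes "open S"
    and "\<And>z. z \<in> S \<Longrightarrow> (f has_derivative D z) (at z)"
    and "\<And>z c x. z \<in> S \<Longrightarrow> D z (c *s x) = c *s D z x"
  shows "holomorphic_map_on f S"
  unfolding holomorphic_map_on_def
proof
  fix z assume z: "z \<in> S"
  with assms(2) complex_linear_has_derivativeI[OF assms(2)[OF z] assms(3)[OF z]]
  show "\<exists>D. (f has_derivative D) (at z within S) \<and> Vector_Spaces.linear (*s) (*s) D"
    using assms(1) by (auto simp: at_within_open[of z S])
qed

lemma holomorphic_map_on_compose: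
  fixes f :: "complex ^ 'n \<Rightarrow> complex ^ 'm" and g :: "complex ^ 'm \<Rightarrow> complex ^ 'k"
  assumes "holomorphic_map_on f S" "holomorphic_map_on g T" "open S" "open T" "f ` S \<subseteq> T"
  shows "holomorphic_map_on (g \<circ> f) S"
proof (rule holomorphic_map_onI[OF \<open>open S\<close>])
  fix z assume z: "z \<in> S"
  then have fz: "f z \<in> T" using assms by auto
  show "(g \<circ> f has_derivative frechet_derivative g (at (f z)) \<circ> frechet_derivative f (at z)) (at z)"
    using assms z fz by (intro diff_chain_at holomorphic_map_onD(1))
  show "(frechet_derivative g (at (f z)) \<circ> frechet_derivative f (at z)) (c *s x) =
      c *s (frechet_derivative g (at (f z)) \<circ> frechet_derivative f (at z)) x" for c x
    using holomorphic_map_onD(2)[OF assms(1,3) z] holomorphic_map_onD(2)[OF assms(2,4) fz] by simp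
qed

lemma Schwarz_ball_unit:
  fixes g :: "complex ^ 'n \<Rightarrow> complex ^ 'm"
  assumes hol: "holomorphic_map_on g (ball 0 1)" and im: "g ` ball 0 1 \<subseteq> ball 0 1"
    and g0: "g 0 = 0" and v: "norm v = 1"
  shows "norm (frechet_derivative g (at 0) v) \<le> 1"
proof (cases "frechet_derivative g (at 0) v = 0")
  case False
  define x where "x = frechet_derivative g (at 0) v"
  \<comment> \<open>The direction of \<open>x\<close> is the unit vector whose pairing with
    \<open>x\<close> attains \<open>norm x\<close>; hence \<open>deriv h 0\<close> will equal
    \<open>norm x\<close>.\<close>
  define w where "w = complex_of_real (1 / norm x) *s x"
  have x: "x \<noteq> 0" using False by (simp add: x_def)
  have w: "norm w = 1" using x by (simp add: w_def norm_cscale norm_divide)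
  define h where "h = (\<lambda>l. cinner (g (l *s v)) w)"
  have ball: "l *s v \<in> ball 0 1" if "norm l < 1" for l
    using that v by (simp add: norm_cscale)
  have deriv: "(h has_field_derivative cinner (frechet_derivative g (at (l *s v)) v) w) (at l)"
    if l: "norm l < 1" for l
  proof (rule has_derivative_imp_has_field_derivative)
    have line: "((\<lambda>l. l *s v) has_derivative (\<lambda>l. l *s v)) (at l)"
      by (auto intro!: derivative_eq_intros)
    have "((\<lambda>l. g (l *s v)) has_derivative (\<lambda>k. frechet_derivative g (at (l *s v)) (k *s v))) (at l)"
      using diff_chain_at[OF line holomorphic_map_onD(1)[OF hol open_ball ball[OF l]]]
      by (simp add: o_def)
    then show "(h has_derivative (\<lambda>k. cinner (frechet_derivative g (at (l *s v)) (k *s v)) w)) (at l)"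
      unfolding h_def by (rule has_derivative_cinner_left)
    \<comment> \<open>Complex homogeneity of the derivative is what turns the real-linear derivative
      of \<open>h\<close> into multiplication by a complex number.\<close>
    show "k * cinner (frechet_derivative g (at (l *s v)) v) w
        = cinner (frechet_derivative g (at (l *s v)) (k *s v)) w" for k
      by (simp add: holomorphic_map_onD(2)[OF hol open_ball ball[OF l]] cinner_scale_left)
  qed
  have "norm (deriv h 0) \<le> 1"
  proof (rule Schwarz_Lemma(2))
    show "h holomorphic_on ball 0 1"
      unfolding holomorphic_on_open[OF open_ball] using deriv by (meson mem_ball_0)
    show "h 0 = 0" by (simp add: h_def g0)
    show "norm (h z) < 1" if "norm z < 1" for z
    proof -
      have "norm (h z) \<le> norm (g (z *s v))"
        using norm_cinner_le[of "g (z *s v)" w] by (simp add: h_def w)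
      also have "\<dots> < 1" using im ball[OF that] by (auto simp: image_subset_iff)
      finally show ?thesis .
    qed
    show "norm (0 :: complex) < 1" by simp
  qed
  moreover have "deriv h 0 = cinner x w"
    using DERIV_imp_deriv[OF deriv[of 0]] by (simp add: x_def)
  moreover have "cinner x w = complex_of_real (norm x)"
    using x by (simp add: w_def cinner_scale_right cinner_self power2_eq_square)
  ultimately show ?thesis by (simp add: x_def)
qed simp

text \<open>Rescales to a unit vector by homogeneity; the zero vector cannot be normalised and is
  treated apart.\<close>

lemma Schwarz_ball:
  fixes g :: "complex ^ 'n \<Rightarrow> complex ^ 'm"
  assumes hol: "holomorphic_map_on g (ball 0 1)" and im: "g ` ball 0 1 \<subseteq> ball 0 1"
    and g0: "g 0 = 0"
  shows "norm (frechet_derivative g (at 0) v) \<le> norm v"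
proof (cases "v = 0")
  case True
  have "frechet_derivative g (at 0) (0 *s 0) = 0 *s frechet_derivative g (at 0) 0"
    by (rule holomorphic_map_onD(2)[OF hol]) auto
  with True show ?thesis by simp
next
  case False
  define c where "c = complex_of_real (1 / norm v)"
  have "norm (frechet_derivative g (at 0) (c *s v)) \<le> 1"
    using False by (intro Schwarz_ball_unit[OF hol im g0]) (simp add: c_def norm_cscale norm_divide)
  moreover have "frechet_derivative g (at 0) (c *s v) = c *s frechet_derivative g (at 0) v"
    by (rule holomorphic_map_onD(2)[OF hol]) auto
  ultimately show ?thesis using False by (simp add: c_def norm_cscale norm_divide field_simps)
qed

section \<open>The automorphisms of the ball\<close>

definition ball_s :: "complex ^ 'n \<Rightarrow> real" where
  "ball_s a = sqrt (1 - (norm a)\<^sup>2)"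

definition ball_lin :: "complex ^ 'n \<Rightarrow> complex ^ 'n \<Rightarrow> complex ^ 'n" where
  "ball_lin a z = complex_of_real (ball_s a) *s z + (cinner z a / complex_of_real (1 + ball_s a)) *s a"

lemma ball_s:
  assumes "norm a < 1"
  shows "ball_s a > 0" "(norm a)\<^sup>2 = 1 - (ball_s a)\<^sup>2"
  using assms by (auto simp: ball_s_def abs_square_less_1 abs_square_le_1 power_le_one)

lemma cinner_self_ball_s:
  assumes "norm a < 1"
  shows "cinner a a = 1 - (complex_of_real (ball_s a))\<^sup>2"
  unfolding cinner_self ball_s(2)[OF assms] by simp

text \<open>\<open>ball_lin a\<close> is \<open>P\<^sub>a + s\<^sub>a Q\<^sub>a\<close>: as \<open>(1 - s\<^sub>a) / \<bar>a\<bar>\<^sup>2 = 1 / (1 + s\<^sub>a)\<close>, the case \<open>a = 0\<close> needs no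
  separate treatment in this form.\<close>

lemma ball_lin_eq:
  assumes "norm a < 1"
  shows "proj_line a z + complex_of_real (ball_s a) *s (z - proj_line a z) = ball_lin a z"
proof (cases "a = 0")
  case False
  define s where "s = complex_of_real (ball_s a)"
  define c where "c = cinner z a"
  have aa: "cinner a a = 1 - s\<^sup>2"
    using cinner_self_ball_s[OF assms] by (simp add: s_def)
  have "1 - s\<^sup>2 \<noteq> 0" using False aa by (metis cinner_self norm_eq_zero of_real_eq_0_iff zero_eq_power2)
  moreover have "1 - s\<^sup>2 = (1 - s) * (1 + s)" by (simp add: algebra_simps power2_eq_square)
  \<comment> \<open>For nonzero \<open>a\<close> the product of the two factors is nonzero, so
    \<open>1 - s\<close> may be cancelled.\<close>
  ultimately have s: "1 - s \<noteq> 0" "1 + s \<noteq> 0" "1 - s\<^sup>2 = (1 - s) * (1 + s)" by auto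
  have "c / (1 - s\<^sup>2) * t + s * (y - c / (1 - s\<^sup>2) * t) = s * y + c / (1 + s) * t" for t y
  proof -
    have "c / (1 - s\<^sup>2) * t + s * (y - c / (1 - s\<^sup>2) * t) = s * y + (1 - s) * c / (1 - s\<^sup>2) * t"
      by (simp add: algebra_simps diff_divide_distrib)
    then show ?thesis using s by simp
  qed
  then have "(c / (1 - s\<^sup>2)) *s a + s *s (z - (c / (1 - s\<^sup>2)) *s a) = s *s z + (c / (1 + s)) *s a"
    by (simp only: vec_eq_iff vector_add_component vector_minus_component vector_smult_component simp_thms)
  then show ?thesis
    using False by (simp only: proj_line_def ball_lin_def aa if_False of_real_add of_real_1
        flip: s_def c_def)
qed (simp add: proj_line_def ball_lin_def)

text \<open>A form without case distinction: an affine numerator over an affine scalar, ready for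
  the quotient rule.\<close>

lemma ball_aut_eq:
  assumes "norm a < 1"
  shows "ball_aut a z = (1 / (1 - cinner z a)) *s (a - ball_lin a z)"
  unfolding ball_aut_def ball_lin_eq[OF assms, symmetric] ball_s_def by (simp add: algebra_simps)

lemma ball_lin_scale: "ball_lin a (c *s z) = c *s ball_lin a z"
  by (simp add: ball_lin_def cinner_scale_left vec_eq_iff algebra_simps)

lemma ball_lin_self:
  assumes "norm a < 1"
  shows "ball_lin a a = a"
proof -
  define s where "s = complex_of_real (ball_s a)"
  have "1 + ball_s a \<noteq> 0" using ball_s[OF assms] by simp
  then have "1 + s \<noteq> 0" by (metis s_def of_real_1 of_real_add of_real_eq_0_iff)
  moreover have "cinner a a = (1 - s) * (1 + s)"
    using cinner_self_ball_s[OF assms] by (simp add: s_def algebra_simps power2_eq_square)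
  ultimately have "cinner a a / (1 + s) = 1 - s" by simp
  then have "ball_lin a a = s *s a + (1 - s) *s a" by (simp add: ball_lin_def flip: s_def)
  then show ?thesis by (simp add: vec_eq_iff algebra_simps)
qed

lemma has_derivative_ball_lin [derivative_intros]:
  "(f has_derivative D) (at x within S) \<Longrightarrow>
    ((\<lambda>x. ball_lin a (f x)) has_derivative (\<lambda>u. ball_lin a (D u))) (at x within S)"
  unfolding ball_lin_def by (auto intro!: derivative_eq_intros simp: divide_inverse)

lemma cinner_ne_1:
  assumes "norm a < 1" "norm z < 1"
  shows "cinner z a \<noteq> 1"
proof -
  have "norm (cinner z a) \<le> norm z * norm a" by (rule norm_cinner_le)
  also have "\<dots> < 1 * 1" using assms by (intro mult_strict_mono') auto
  finally show ?thesis by auto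
qed

text \<open>The quotient rule for \<open>ball_aut_eq\<close> at \<open>z\<close> in direction
  \<open>u\<close>: the first term differentiates the scalar factor, the second the
  numerator.\<close>

definition ball_aut_deriv :: "complex ^ 'n \<Rightarrow> complex ^ 'n \<Rightarrow> complex ^ 'n \<Rightarrow> complex ^ 'n" where
  "ball_aut_deriv a z u = (cinner u a / (1 - cinner z a)\<^sup>2) *s (a - ball_lin a z)
     - (1 / (1 - cinner z a)) *s ball_lin a u"

lemma has_derivative_ball_aut:
  assumes "norm a < 1" "norm z < 1"
  shows "(ball_aut a has_derivative ball_aut_deriv a z) (at z)"
proof -
  have "((\<lambda>z. (1 / (1 - cinner z a)) *s (a - ball_lin a z)) has_derivative ball_aut_deriv a z) (at z)"
    using cinner_ne_1[OF assms]
    by (auto intro!: derivative_eq_intros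
        simp: ball_aut_deriv_def vec_eq_iff fun_eq_iff field_simps power2_eq_square)
  moreover have "ball_aut a = (\<lambda>z. (1 / (1 - cinner z a)) *s (a - ball_lin a z))"
    using ball_aut_eq[OF assms(1)] by blast
  ultimately show ?thesis by simp
qed

lemma frechet_derivative_ball_aut:
  assumes "norm a < 1" "norm z < 1"
  shows "frechet_derivative (ball_aut a) (at z) = ball_aut_deriv a z"
  using frechet_derivative_at[OF has_derivative_ball_aut[OF assms]] by simp

lemma holomorphic_ball_aut:
  assumes "norm a < 1"
  shows "holomorphic_map_on (ball_aut a) (ball 0 1)"
proof (rule holomorphic_map_onI)
  show "(ball_aut a has_derivative ball_aut_deriv a z) (at z)" if "z \<in> ball 0 1" for z
    using that assms by (intro has_derivative_ball_aut) auto
  show "ball_aut_deriv a z (c *s x) = c *s ball_aut_deriv a z x" for z c x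
    by (simp add: ball_aut_deriv_def ball_lin_scale cinner_scale_left vec_eq_iff algebra_simps)
qed auto

text \<open>Rests on |1 - <z,a>|^2 - |a - L z|^2 = s^2 (1 - |z|^2) with L =
  \<open>ball_lin a\<close>, whose right side is positive.\<close>

lemma norm_ball_aut_less_1:
  assumes "norm a < 1" "norm z < 1"
  shows "norm (ball_aut a z) < 1"
proof -
  define s where "s = ball_s a"
  define c where "c = cinner z a"
  define t where "t = complex_of_real (1 / (1 + s))"
  have s: "s > 0" "(norm a)\<^sup>2 = 1 - s\<^sup>2" using ball_s[OF assms(1)] by (simp_all add: s_def)
  have c1: "c \<noteq> 1" using cinner_ne_1[OF assms] by (simp add: c_def)
  \<comment> \<open>As a combination of \<open>a\<close> and \<open>z\<close>, the numerator has a
    squared norm depending only on \<open>s\<close>, \<open>c\<close> and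
    \<open>norm z\<close>.\<close>
  have eq: "a - ball_lin a z = (1 - t * c) *s a - complex_of_real s *s z"
    by (simp add: ball_lin_def vec_eq_iff algebra_simps flip: s_def c_def t_def) (simp add: t_def)
  have r: "Re t = 1 / (1 + s)" "Im t = 0" by (simp_all add: t_def)
  have "(norm (a - ball_lin a z))\<^sup>2 = Re (cinner (a - ball_lin a z) (a - ball_lin a z))"
    by (simp add: cinner_self)
  also have "\<dots> = (norm (1 - t * c))\<^sup>2 * (1 - s\<^sup>2) - 2 * s * Re ((1 - t * c) * cnj c) + s\<^sup>2 * (norm z)\<^sup>2"
    unfolding eq
    unfolding cinner_diff_left cinner_diff_right cinner_scale_left cinner_scale_right
      cinner_commute[of a z]
    unfolding cinner_self c_def[symmetric] s(2)
    unfolding cmod_power2 by (simp add: algebra_simps power2_eq_square)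
  also have "\<dots> = 1 - s\<^sup>2 - 2 * Re c + (norm c)\<^sup>2 + s\<^sup>2 * (norm z)\<^sup>2"
  proof -
    \<comment> \<open>\<open>q\<close> is the real value of \<open>t\<close>. The relation
      \<open>q * s = 1 - q\<close> is free of division and reduces both coefficients below to
      1.\<close>
    define q where "q = 1 / (1 + s)"
    have q: "q * s = 1 - q" using s by (simp add: q_def field_simps)
    have "(norm (1 - t * c))\<^sup>2 * (1 - s\<^sup>2) - 2 * s * Re ((1 - t * c) * cnj c)
        = 1 - s\<^sup>2 - 2 * Re c * (q * (1 - s\<^sup>2) + s) + (norm c)\<^sup>2 * (q\<^sup>2 * (1 - s\<^sup>2) + 2 * (q * s))"
      unfolding cmod_power2 using r by (simp add: q_def[symmetric] algebra_simps power2_eq_square)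
    moreover have "q * (1 - s\<^sup>2) + s = 1"
      using q by algebra
    moreover have "q\<^sup>2 * (1 - s\<^sup>2) + 2 * (q * s) = 1"
      using q by algebra
    ultimately show ?thesis by simp
  qed
  also have "\<dots> = (norm (1 - c))\<^sup>2 - s\<^sup>2 * (1 - (norm z)\<^sup>2)"
    unfolding cmod_power2 by (simp add: algebra_simps power2_eq_square)
  also have "\<dots> < (norm (1 - c))\<^sup>2"
    using s(1) assms(2) by (simp add: abs_square_less_1)
  finally have "norm (a - ball_lin a z) < norm (1 - c)"
    by (rule power2_less_imp_less) simp
  then show ?thesis
    using c1 by (simp add: ball_aut_eq[OF assms(1)] norm_cscale norm_divide del: vector_ssub_ldistrib flip: c_def)
qed

lemma ball_aut_zero:
  assumes "norm a < 1"
  shows "ball_aut a 0 = a"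
  by (simp add: ball_aut_eq[OF assms] ball_lin_def)

lemma ball_aut_self:
  assumes "norm a < 1"
  shows "ball_aut a a = 0"
  by (simp add: ball_aut_eq[OF assms] ball_lin_self[OF assms])

text \<open>Write L = \<open>ball_lin a\<close> = P + s Q. The derivative at \<open>a\<close> is -L
  / s^2, the one at 0 sends x to <x,a> a - L x. Since <L u,a> = <u,a>, <u,a> a = (1 - s^2) P u and
  L^2 = P + s^2 Q, the latter sends L u to -s^2 u, and the factors cancel.\<close>

lemma ball_aut_deriv_zero_self:
  assumes "norm a < 1"
  shows "ball_aut_deriv a 0 (ball_aut_deriv a a u) = u"
proof -
  define s where "s = complex_of_real (ball_s a)"
  define c where "c = cinner u a"
  define q where "q = 1 / (1 + s)"
  have s0: "ball_s a > 0" using ball_s[OF assms] by simp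
  then have "s \<noteq> 0" "1 + s \<noteq> 0"
    by (auto simp: s_def complex_eq_iff)
  then have q: "q * (1 + s) = 1" by (simp add: q_def)
  have aa: "cinner a a = 1 - s\<^sup>2"
    using cinner_self_ball_s[OF assms] by (simp add: s_def)
  have lin: "ball_lin a x = s *s x + (q * cinner x a) *s a" for x
    by (simp add: ball_lin_def q_def s_def)
  \<comment> \<open>The numerator a - L a vanishes, so only the second term of the quotient rule
    survives.\<close>
  have D: "ball_aut_deriv a a u = (- 1 / s\<^sup>2) *s ball_lin a u"
    by (simp add: ball_aut_deriv_def ball_lin_self[OF assms] aa vec_eq_iff)
  have lin_cinner: "cinner (ball_lin a u) a = c"
    using q by (simp add: lin cinner_add_left cinner_scale_left aa flip: c_def) algebra
  have "ball_aut_deriv a 0 (ball_lin a u) = c *s a - ball_lin a (ball_lin a u)"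
    by (simp add: ball_aut_deriv_def lin_cinner) (simp add: ball_lin_def)
  also have "\<dots> = (- s\<^sup>2) *s u"
  proof -
    \<comment> \<open>One component of the identity: \<open>t\<close> and \<open>y\<close> stand for
      entries of \<open>a\<close> and \<open>u\<close>.\<close>
    have "c * t - (s * (s * y + q * c * t) + q * c * t) = - s\<^sup>2 * y" for t y
      using q by algebra
    then show ?thesis
      unfolding lin[of "ball_lin a u"] lin_cinner unfolding lin c_def[symmetric]
      by (simp only: vec_eq_iff vector_add_component vector_minus_component vector_smult_component simp_thms)
  qed
  finally have *: "ball_aut_deriv a 0 (ball_lin a u) = (- s\<^sup>2) *s u" .
  have scale: "ball_aut_deriv a 0 (k *s x) = k *s ball_aut_deriv a 0 x" for k x
    using holomorphic_map_onD(2)[OF holomorphic_ball_aut[OF assms], of 0]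
    by (simp add: frechet_derivative_ball_aut[OF assms])
  show ?thesis unfolding D scale * using \<open>s \<noteq> 0\<close> by (simp add: vec_eq_iff)
qed

lemma M_dil_mult_norm:
  assumes "norm p < 1"
  shows "M_dil p u * norm u = norm (ball_aut_deriv p p u)"
proof (cases "u = 0")
  case True
  \<comment> \<open>Division by zero makes the left side 0, and the derivative formula is 0 at the
    zero vector too.\<close>
  then show ?thesis by (simp add: ball_aut_deriv_def ball_lin_def)
next
  case False
  then show ?thesis by (simp add: M_dil_def frechet_derivative_ball_aut[OF assms assms])
qed

theorem theorem6:
  fixes f :: "complex ^ 'n \<Rightarrow> complex ^ 'm"
    and a u :: "complex ^ 'n"
    and b u_star :: "complex ^ 'm"
  assumes "holomorphic_map_on f (ball 0 1)"
    and "f ` ball 0 1 \<subseteq> ball 0 1"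
    and "a \<in> ball 0 1"
    and "b = f a"
    and "u_star = frechet_derivative f (at a) u"
  shows "M_dil b u_star * norm u_star \<le> M_dil a u * norm u"
proof -
  have a: "norm a < 1" using assms by simp
  have b: "norm b < 1" using assms by (auto simp: image_subset_iff)
  define g where "g = ball_aut b \<circ> (f \<circ> ball_aut a)"
  have im: "ball_aut a ` ball 0 1 \<subseteq> ball 0 1" "ball_aut b ` ball 0 1 \<subseteq> ball 0 1"
    using norm_ball_aut_less_1[OF a] norm_ball_aut_less_1[OF b] by auto
  then have im': "(f \<circ> ball_aut a) ` ball 0 1 \<subseteq> ball 0 1" using assms(2) by fastforce
  have hol: "holomorphic_map_on g (ball 0 1)"
    unfolding g_def
    using assms(1) holomorphic_ball_aut[OF a] holomorphic_ball_aut[OF b] im(1) im'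
    by (intro holomorphic_map_on_compose[where T = "ball 0 1"]) auto
  have g_im: "g ` ball 0 1 \<subseteq> ball 0 1" using im(2) im' unfolding g_def by fastforce
  have g0: "g 0 = 0"
    using assms(4) ball_aut_self[OF b] by (simp add: g_def ball_aut_zero[OF a])
  \<comment> \<open>The chain rule along 0, \<open>a\<close>, \<open>b\<close>, 0.\<close>
  have "(g has_derivative
      ball_aut_deriv b b \<circ> (frechet_derivative f (at a) \<circ> ball_aut_deriv a 0)) (at 0)"
    unfolding g_def
    using has_derivative_ball_aut[OF a, of 0] has_derivative_ball_aut[OF b b]
      holomorphic_map_onD(1)[OF assms(1) open_ball assms(3)] assms(4)
    by (intro diff_chain_at) (auto simp: ball_aut_zero[OF a])
  \<comment> \<open>The argument is chosen so that the innermost derivative returns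
    \<open>u\<close>, which \<open>f\<close> then carries to \<open>u_star\<close>.\<close>
  from frechet_derivative_at[OF this]
  have "frechet_derivative g (at 0) (ball_aut_deriv a a u) = ball_aut_deriv b b u_star"
    by (metis assms(5) ball_aut_deriv_zero_self[OF a] comp_apply)
  then have "norm (ball_aut_deriv b b u_star) \<le> norm (ball_aut_deriv a a u)"
    using Schwarz_ball[OF hol g_im g0, of "ball_aut_deriv a a u"] by simp
  then show ?thesis by (simp add: M_dil_mult_norm[OF a] M_dil_mult_norm[OF b])
qed

end
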